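(* Let $a\in\mathbb{R}$, $b\in\mathbb{N}_{a+2}$, $0<\nu<1$, $p:\mathbb{N}_{a+1}\to(0,\infty)$, $q:\mathbb{N}_{a+1}\to\mathbb{R}$, and $(L_ax)(t)=\nabla[p(t+1)\nabla_{a*}^{\nu}x(t+1)]+q(t)x(t)$. Let $\alpha,\beta,\gamma,\delta\in\mathbb{R}$ with $\alpha^2+\beta^2>0$ and $\gamma^2+\delta^2>0$. Assume that the homogeneous boundary value problem $$L_ax(t)=0\ \ (t\in\mathbb{N}_{a+1}^{b-1}),\qquad \alpha x(a)-\beta\nabla x(a+1)=0,\qquad \gamma x(b)+\delta\nabla x(b)=0,$$ for $x:\mathbb{N}_a^b\to\mathbb{R}$, has only the trivial solution $x\equiv 0$. Then for every $h:\mathbb{N}_{a+1}^{b-1}\to\mathbb{R}$ and all $A,B\in\mathbb{R}$ the boundary value problem $$L_ax(t)=h(t)\ \ (t\in\mathbb{N}_{a+1}^{b-1}),\qquad \alpha x(a)-\beta\nabla x(a+1)=A,\qquad \gamma x(b)+\delta\nabla x(b)=B,$$ has a unique solution $x:\mathbb{N}_a^b\to\mathbb{R}$.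
   Context: For $a\in\mathbb{R}$, $\mathbb{N}_a=\{a,a+1,a+2,\dots\}$, and for $b\in\mathbb{N}_a$, $\mathbb{N}_a^b=\{a,a+1,\dots,b\}$. The nabla difference is $\nabla f(t)=f(t)-f(t-1)$. The generalized rising function is $t^{\overline{\mu}}=\Gamma(t+\mu)/\Gamma(t)$, with the convention $t^{\overline{\mu}}=0$ if $t$ is a non-positive integer and $t+\mu$ is not a non-positive integer. For $0<\nu<1$ the Caputo nabla fractional difference based at $a$ is $\nabla_{a*}^{\nu}x(t)=\sum_{\tau=a+1}^{t}\frac{(t-\tau+1)^{\overline{-\nu}}}{\Gamma(1-\nu)}\nabla x(\tau)$ (empty sums are $0$); $\nabla_{a*}^{\nu}x(t+1)$ denotes its value at $t+1$. In $L_a$ the outer $\nabla$ acts in $t$, so $\nabla[p(t+1)\nabla_{a*}^{\nu}x(t+1)]=p(t+1)\nabla_{a*}^{\nu}x(t+1)-p(t)\nabla_{a*}^{\nu}x(t)$; for $t\in\mathbb{N}_{a+1}^{b-1}$ this only involves values of $x$ on $\mathbb{N}_a^b$. *)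

theory Defs
  imports "HOL-Analysis.Analysis"
begin

definition nats_from :: "real \<Rightarrow> real set" where
  "nats_from a = {a + real k | k. True}"

definition nats_between :: "real \<Rightarrow> real \<Rightarrow> real set" where
  "nats_between a b = {t \<in> nats_from a. t \<le> b}"

definition nabla :: "(real \<Rightarrow> real) \<Rightarrow> real \<Rightarrow> real" where
  "nabla f t = f t - f (t - 1)"

text \<open>The quotient is only meaningful where \<open>t + \<mu>\<close> is not a pole of the Gamma function; the Caputo
  difference below uses it only at arguments \<open>t \<ge> 1\<close> with \<open>-1 < \<mu> < 0\<close>.\<close>

definition rising :: "real \<Rightarrow> real \<Rightarrow> real" where
  "rising t \<mu> =
    (if t \<in> \<int>\<^sub>\<le>\<^sub>0 \<and> t + \<mu> \<notin> \<int>\<^sub>\<le>\<^sub>0 then 0 else Gamma (t + \<mu>) / Gamma t)"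

definition caputo_nabla :: "real \<Rightarrow> real \<Rightarrow> (real \<Rightarrow> real) \<Rightarrow> real \<Rightarrow> real" where
  "caputo_nabla \<nu> a x t =
    (\<Sum>\<tau>\<in>nats_between (a + 1) t. rising (t - \<tau> + 1) (- \<nu>) / Gamma (1 - \<nu>) * nabla x \<tau>)"

definition L_op ::
  "real \<Rightarrow> real \<Rightarrow> (real \<Rightarrow> real) \<Rightarrow> (real \<Rightarrow> real) \<Rightarrow> (real \<Rightarrow> real) \<Rightarrow> real \<Rightarrow> real" where
  "L_op \<nu> a p q x t = nabla (\<lambda>s. p (s + 1) * caputo_nabla \<nu> a x (s + 1)) t + q t * x t"

text \<open>A function on \<open>nats_between a b\<close> is represented as an extensional function, i.e. it takes the
  fixed value \<^const>\<open>undefined\<close> outside that set, so that equality in the function type coincides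
  with equality on \<open>nats_between a b\<close>.\<close>

definition solves_bvp ::
  "real \<Rightarrow> real \<Rightarrow> real \<Rightarrow> (real \<Rightarrow> real) \<Rightarrow> (real \<Rightarrow> real) \<Rightarrow> real \<Rightarrow> real \<Rightarrow> real \<Rightarrow> real \<Rightarrow>
    (real \<Rightarrow> real) \<Rightarrow> real \<Rightarrow> real \<Rightarrow> (real \<Rightarrow> real) \<Rightarrow> bool" where
  "solves_bvp \<nu> a b p q \<alpha> \<beta> \<gamma> \<delta> h A B x \<longleftrightarrow>
    x \<in> nats_between a b \<rightarrow>\<^sub>E UNIV \<and>
    (\<forall>t\<in>nats_between (a + 1) (b - 1). L_op \<nu> a p q x t = h t) \<and>
    \<alpha> * x a - \<beta> * nabla x (a + 1) = A \<and>
    \<gamma> * x b + \<delta> * nabla x b = B"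

end

(* After the Caputo difference is expanded, every left-hand side of the boundary value problem is a
   linear form in the values of x on nats_between a b, with one equation for every point of
   that set: the two boundary conditions stand for the points a and b.  So the problem is a square
   linear system, whose solvability for every right-hand side is equivalent to the triviality of
   its kernel. *)
theory Submission
  imports Defs "Jordan_Normal_Form.Determinant"
begin

text \<open>One coefficient family \<open>c\<close> serves every \<open>x\<close>, and
  \<open>x\<close> ranges over total functions, so such an \<open>f\<close> cannot depend on values
  outside \<open>S\<close>. Indexing by \<open>S\<close> itself lets grid points label unknowns and
  equations directly.\<close>

definition linear_form :: "'a set \<Rightarrow> (('a \<Rightarrow> 'b::comm_ring_1) \<Rightarrow> 'b) \<Rightarrow> bool" where
  "linear_form S f \<longleftrightarrow> (\<exists>c. \<forall>x. f x = (\<Sum>s\<in>S. c s * x s))"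

lemma linear_form_eval:
  assumes "finite S" "s \<in> S"
  shows "linear_form S (\<lambda>x. x s)"
  unfolding linear_form_def
proof (intro exI allI)
  show "x s = (\<Sum>r\<in>S. (if r = s then 1 else 0) * x r)" for x :: "'a \<Rightarrow> 'b"
    using assms by (simp add: if_distrib[of "\<lambda>c. c * _"] sum.delta cong: if_cong)
qed

lemma linear_form_0: "linear_form S (\<lambda>x. 0)"
  unfolding linear_form_def by (rule exI[of _ "\<lambda>_. 0"]) simp

lemma linear_form_add:
  assumes "linear_form S f" "linear_form S g"
  shows "linear_form S (\<lambda>x. f x + g x)"
proof -
  obtain c d where "\<And>x. f x = (\<Sum>s\<in>S. c s * x s)" "\<And>x. g x = (\<Sum>s\<in>S. d s * x s)"
    using assms unfolding linear_form_def by blast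
  then have "f x + g x = (\<Sum>s\<in>S. (c s + d s) * x s)" for x
    by (simp add: sum.distrib distrib_right)
  then show ?thesis
    unfolding linear_form_def by (intro exI[of _ "\<lambda>s. c s + d s"] allI)
qed

lemma linear_form_mult:
  assumes "linear_form S f"
  shows "linear_form S (\<lambda>x. k * f x)"
proof -
  obtain c where "\<And>x. f x = (\<Sum>s\<in>S. c s * x s)"
    using assms unfolding linear_form_def by blast
  then have "k * f x = (\<Sum>s\<in>S. (k * c s) * x s)" for x
    by (simp add: sum_distrib_left mult.assoc)
  then show ?thesis
    unfolding linear_form_def by (intro exI[of _ "\<lambda>s. k * c s"] allI)
qed

lemma linear_form_diff:
  assumes "linear_form S f" "linear_form S g"
  shows "linear_form S (\<lambda>x. f x - g x)"
  using linear_form_add[OF assms(1) linear_form_mult[OF assms(2), of "- 1"]] by simp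

lemma linear_form_sum:
  assumes "\<And>i. i \<in> I \<Longrightarrow> linear_form S (f i)"
  shows "linear_form S (\<lambda>x. \<Sum>i\<in>I. f i x)"
  using assms
  by (induction I rule: infinite_finite_induct) (auto intro: linear_form_0 linear_form_add)

text \<open>A square matrix with trivial kernel has nonzero determinant, hence is invertible.
  Library matrices are indexed by initial segments of the naturals, so \<open>S\<close> is first
  enumerated by \<open>g\<close>, with inverse \<open>f\<close>.\<close>

lemma square_matrix_surj:
  fixes M :: "'a \<Rightarrow> 'a \<Rightarrow> 'b::field"
  assumes fin: "finite S"
    and ker: "\<And>x. (\<And>t. t \<in> S \<Longrightarrow> (\<Sum>s\<in>S. M t s * x s) = 0) \<Longrightarrow> \<forall>s\<in>S. x s = 0"
  shows "\<exists>x. \<forall>t\<in>S. (\<Sum>s\<in>S. M t s * x s) = y t"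
proof -
  obtain g where g: "bij_betw g {0..<card S} S"
    using ex_bij_betw_nat_finite[OF fin] by blast
  define n where "n = card S"
  define f where "f = inv_into {0..<n} g"
  have gS: "g i \<in> S" if "i < n" for i
    using g that by (auto simp: bij_betw_def n_def)
  have fg: "f (g i) = i" if "i < n" for i
    using g that by (auto simp: bij_betw_def n_def f_def)
  have fS: "f t < n" "g (f t) = t" if "t \<in> S" for t
    using bij_betw_inv_into[OF g] bij_betw_inv_into_right[OF g] that
    by (auto simp: n_def f_def bij_betw_def)
  define A where "A = Matrix.mat n n (\<lambda>(i, j). M (g i) (g j))"
  have A: "A \<in> carrier_mat n n"
    by (simp add: A_def)
  \<comment> \<open>Dictionary between the two indexings: a vector \<open>v\<close> stands for the
    function sending \<open>s\<close> to entry \<open>f s\<close> of \<open>v\<close>. It serves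
    both for the kernel and for the solution.\<close>
  have Av: "vec_index (A *\<^sub>v v) (f t) = (\<Sum>s\<in>S. M t s * vec_index v (f s))"
    if "v \<in> carrier_vec n" "t \<in> S" for v t
  proof -
    have "vec_index (A *\<^sub>v v) (f t) = (\<Sum>j\<in>{0..<n}. M t (g j) * vec_index v (f (g j)))"
      using that by (simp add: A_def fS fg scalar_prod_def)
    also have "\<dots> = (\<Sum>s\<in>S. M t s * vec_index v (f s))"
      using sum.reindex_bij_betw[OF g] by (simp add: n_def)
    finally show ?thesis .
  qed
  have "v = 0\<^sub>v n" if v: "v \<in> carrier_vec n" "A *\<^sub>v v = 0\<^sub>v n" for v
  proof (rule eq_vecI)
    have "\<forall>s\<in>S. vec_index v (f s) = 0"
    proof (rule ker)
      show "(\<Sum>s\<in>S. M t s * vec_index v (f s)) = 0" if "t \<in> S" for t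
        using Av[OF v(1) that] v(2) fS(1)[OF that] by simp
    qed
    then show "vec_index v i = vec_index (0\<^sub>v n) i" if "i < dim_vec (0\<^sub>v n)" for i
      using that gS[of i] fg[of i] by force
  qed (use v in simp)
  then have "Determinant.det A \<noteq> 0"
    using det_0_iff_vec_prod_zero_field[OF A] by blast
  \<comment> \<open>The argument \<open>()\<close> only fills the extension field of the matrix ring
    record. Of the two-sided inverse, the half \<open>A * B = 1\<close> gives solvability, with
    solution vector \<open>B\<close> applied to \<open>w\<close>.\<close>
  from det_non_zero_imp_unit[OF A this, of "()"] obtain B
    where B: "B \<in> carrier_mat n n" and AB: "A * B = 1\<^sub>m n"
    unfolding Units_def ring_mat_def by auto
  define w where "w = Matrix.vec n (\<lambda>i. y (g i))"
  have w: "w \<in> carrier_vec n"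
    by (simp add: w_def)
  have "A *\<^sub>v (B *\<^sub>v w) = w"
    using assoc_mult_mat_vec[OF A B w] AB w by simp
  then have "(\<Sum>s\<in>S. M t s * vec_index (B *\<^sub>v w) (f s)) = y t" if "t \<in> S" for t
    using Av[of "B *\<^sub>v w" t] mult_mat_vec_carrier[OF B w] that by (simp add: w_def fS)
  then show ?thesis
    by (intro exI[of _ "\<lambda>s. vec_index (B *\<^sub>v w) (f s)"]) simp
qed

text \<open>Existence is surjectivity of the coefficient matrix; uniqueness is the kernel condition
  applied to the difference of two solutions. Extensional functions appear so that agreement on
  \<open>S\<close> is equality.\<close>

lemma square_linear_system_unique_solution:
  fixes F :: "'a \<Rightarrow> ('a \<Rightarrow> 'b::field) \<Rightarrow> 'b"
  assumes fin: "finite S"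
    and lin: "\<And>t. t \<in> S \<Longrightarrow> linear_form S (F t)"
    and ker: "\<And>x. x \<in> S \<rightarrow>\<^sub>E UNIV \<Longrightarrow> \<forall>t\<in>S. F t x = 0 \<Longrightarrow> \<forall>s\<in>S. x s = 0"
  shows "\<exists>!x. x \<in> S \<rightarrow>\<^sub>E UNIV \<and> (\<forall>t\<in>S. F t x = y t)"
proof -
  have "\<forall>t. \<exists>c. t \<in> S \<longrightarrow> (\<forall>x. F t x = (\<Sum>s\<in>S. c s * x s))"
    using lin unfolding linear_form_def by blast
  then obtain M where F: "\<And>t x. t \<in> S \<Longrightarrow> F t x = (\<Sum>s\<in>S. M t s * x s)"
    by metis
  have F_restrict: "F t (restrict x S) = F t x" if "t \<in> S" for t x
    using F[OF that] by simp
  \<comment> \<open>Extends the kernel condition to functions that need not be extensional, such as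
    the pointwise difference \<open>z s - x s\<close> below.\<close>
  have ker': "\<forall>s\<in>S. x s = 0" if "\<And>t. t \<in> S \<Longrightarrow> F t x = 0" for x
    using ker[of "restrict x S"] that F_restrict by simp
  have "\<exists>x. \<forall>t\<in>S. (\<Sum>s\<in>S. M t s * x s) = y t"
    by (rule square_matrix_surj[OF fin], rule ker') (simp add: F)
  then obtain x where x: "\<And>t. t \<in> S \<Longrightarrow> F t x = y t"
    using F by fastforce
  show ?thesis
  proof (rule ex1I[of _ "restrict x S"])
    show "restrict x S \<in> S \<rightarrow>\<^sub>E UNIV \<and> (\<forall>t\<in>S. F t (restrict x S) = y t)"
      using x F_restrict by auto
    show "z = restrict x S" if z: "z \<in> S \<rightarrow>\<^sub>E UNIV \<and> (\<forall>t\<in>S. F t z = y t)" for z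
    proof -
      have "F t (\<lambda>s. z s - x s) = 0" if "t \<in> S" for t
      proof -
        have "F t (\<lambda>s. z s - x s) = F t z - F t x"
          by (simp add: F[OF that] right_diff_distrib sum_subtractf)
        then show ?thesis
          using x z that by simp
      qed
      then have "\<forall>s\<in>S. z s - x s = 0"
        by (rule ker')
      with z show ?thesis
        by (auto simp: PiE_def extensional_def restrict_def fun_eq_iff)
    qed
  qed
qed

lemma finite_nats_between: "finite (nats_between a b)"
proof (rule finite_subset)
  show "nats_between a b \<subseteq> (\<lambda>k. a + real k) ` {..nat \<lceil>b - a\<rceil>}"
    unfolding nats_between_def nats_from_def by (auto intro!: imageI) linarith
qed simp

lemma nats_from_add: "t \<in> nats_from a \<Longrightarrow> t + real k \<in> nats_from a"
  unfolding nats_from_def by clarsimp (metis add.assoc of_nat_add)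

lemma nats_from_ge: "t \<in> nats_from a \<Longrightarrow> a \<le> t"
  unfolding nats_from_def by auto

lemma nats_from_base: "a \<in> nats_from a"
  unfolding nats_from_def by (auto intro: exI[of _ 0])

lemma nats_from_shift: "t \<in> nats_from (a + real k) \<Longrightarrow> t - real k \<in> nats_from a"
  unfolding nats_from_def by auto

text \<open>This is the count of equations against unknowns: the operator equation is posed at the
  interior points, which leaves exactly the two end points for the boundary conditions.\<close>

lemma nats_between_split:
  assumes "b \<in> nats_from (a + 1)"
  shows "nats_between a b = insert a (insert b (nats_between (a + 1) (b - 1)))"
proof -
  \<comment> \<open>The grid has indices 0 to \<open>Suc n\<close>; the interior ones are 1 to
    \<open>n\<close>, an empty range when \<open>b = a + 1\<close>.\<close>
  obtain n where b: "b = a + 1 + real n"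
    using assms unfolding nats_from_def by auto
  have "t = a \<or> t = b \<or> t \<in> nats_between (a + 1) (b - 1)" if "t \<in> nats_between a b" for t
  proof -
    obtain k where k: "t = a + real k" "k \<le> Suc n"
      using \<open>t \<in> nats_between a b\<close> unfolding nats_between_def nats_from_def b by auto
    show ?thesis
    proof (cases "k = 0 \<or> k = Suc n")
      case False
      then obtain j where "k = Suc j" "j < n"
        using k(2) by (cases k) auto
      then have "t = a + 1 + real j" "t \<le> b - 1"
        using k(1) by (simp_all add: b)
      then show ?thesis
        unfolding nats_between_def nats_from_def by blast
    qed (use k b in auto)
  qed
  moreover have "a \<in> nats_between a b" "b \<in> nats_between a b"
    using nats_from_base nats_from_add[OF nats_from_base, of a "Suc n"]
    by (auto simp: nats_between_def b add_ac)
  moreover have "t \<in> nats_between a b" if "t \<in> nats_between (a + 1) (b - 1)" for t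
    using nats_from_add[OF nats_from_shift[of t a 1], of 1] that by (auto simp: nats_between_def)
  ultimately show ?thesis
    by blast
qed

text \<open>The difference reaches one point back, so starting at \<open>a + 1\<close> keeps
  \<open>t - 1\<close> on the grid.\<close>

lemma linear_form_nabla:
  assumes "t \<in> nats_between (a + 1) b"
  shows "linear_form (nats_between a b) (\<lambda>x. nabla x t)"
proof -
  have "t - 1 \<in> nats_between a b"
    using nats_from_shift[of t a 1] assms by (auto simp: nats_between_def)
  moreover have "t \<in> nats_between a b"
    using nats_from_add[OF nats_from_shift[of t a 1], of 1] assms by (auto simp: nats_between_def)
  ultimately show ?thesis
    unfolding nabla_def by (intro linear_form_diff linear_form_eval finite_nats_between)
qed

text \<open>The weights do not involve \<open>x\<close>, and the differences that enter are taken at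
  points up to \<open>t\<close>, hence up to \<open>b\<close>.\<close>

lemma linear_form_caputo_nabla:
  assumes "t \<le> b"
  shows "linear_form (nats_between a b) (\<lambda>x. caputo_nabla \<nu> a x t)"
  unfolding caputo_nabla_def
proof (intro linear_form_sum linear_form_mult linear_form_nabla)
  show "\<tau> \<in> nats_between (a + 1) b" if "\<tau> \<in> nats_between (a + 1) t" for \<tau>
    using that assms by (auto simp: nats_between_def)
qed

text \<open>The outer difference uses the Caputo difference at \<open>t + 1\<close> and at
  \<open>t\<close>; the bound \<open>t \<le> b - 1\<close> keeps both within the grid.\<close>

lemma linear_form_L_op:
  assumes "t \<in> nats_between (a + 1) (b - 1)"
  shows "linear_form (nats_between a b) (\<lambda>x. L_op \<nu> a p q x t)"
proof -
  have "t \<in> nats_between a b"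
    using nats_from_add[OF nats_from_shift[of t a 1], of 1] assms by (auto simp: nats_between_def)
  then show ?thesis
    using assms unfolding L_op_def nabla_def
    by (intro linear_form_add linear_form_diff linear_form_mult linear_form_caputo_nabla
        linear_form_eval finite_nats_between) (auto simp: nats_between_def)
qed

theorem theorem26:
  fixes a b \<nu> \<alpha> \<beta> \<gamma> \<delta> :: real and p q :: "real \<Rightarrow> real"
  assumes "b \<in> nats_from (a + 2)"
    and "0 < \<nu>" and "\<nu> < 1"
    and "\<And>t. t \<in> nats_from (a + 1) \<Longrightarrow> 0 < p t"
    and "\<alpha>\<^sup>2 + \<beta>\<^sup>2 > 0" and "\<gamma>\<^sup>2 + \<delta>\<^sup>2 > 0"
    and "\<And>x. solves_bvp \<nu> a b p q \<alpha> \<beta> \<gamma> \<delta> (\<lambda>t. 0) 0 0 x \<Longrightarrow> \<forall>t\<in>nats_between a b. x t = 0"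
  shows "\<forall>(h :: real \<Rightarrow> real) A B. \<exists>!x. solves_bvp \<nu> a b p q \<alpha> \<beta> \<gamma> \<delta> h A B x"
proof (intro allI)
  fix h :: "real \<Rightarrow> real" and A B :: real
  let ?S = "nats_between a b" and ?T = "nats_between (a + 1) (b - 1)"
  define F where "F t x =
    (if t = a then \<alpha> * x a - \<beta> * nabla x (a + 1)
     else if t = b then \<gamma> * x b + \<delta> * nabla x b
     else L_op \<nu> a p q x t)" for t x
  have b1: "b \<in> nats_from (a + 1)"
    using nats_from_add[OF nats_from_shift[of b "a + 1" 1], of 1] assms(1) by (simp add: add_ac)
  have "a + 2 \<le> b"
    using nats_from_ge[OF assms(1)] .
  have S: "?S = insert a (insert b ?T)"
    using nats_between_split[OF b1] .
  \<comment> \<open>Ensures that the case split in \<open>F\<close> assigns exactly one equation to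
    each grid point, so that no equation is masked by another.\<close>
  have distinct: "a \<noteq> b" "a \<notin> ?T" "b \<notin> ?T"
    using \<open>a + 2 \<le> b\<close> by (auto simp: nats_between_def dest: nats_from_ge)
  \<comment> \<open>Stated for arbitrary data because it is used twice: with zero data for the
    kernel and with the given \<open>h\<close>, \<open>A\<close>, \<open>B\<close> for the
    conclusion.\<close>
  have solves: "solves_bvp \<nu> a b p q \<alpha> \<beta> \<gamma> \<delta> h A B x \<longleftrightarrow>
      x \<in> ?S \<rightarrow>\<^sub>E UNIV \<and> (\<forall>t\<in>?S. F t x = (if t = a then A else if t = b then B else h t))"
    for h A B x
  proof -
    have "F t x = (if t = a then A else if t = b then B else h t) \<longleftrightarrow> L_op \<nu> a p q x t = h t"
      if "t \<in> ?T" for t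
      using that distinct by (auto simp: F_def)
    then have "(\<forall>t\<in>?S. F t x = (if t = a then A else if t = b then B else h t)) \<longleftrightarrow>
      (\<forall>t\<in>?T. L_op \<nu> a p q x t = h t) \<and>
      \<alpha> * x a - \<beta> * nabla x (a + 1) = A \<and> \<gamma> * x b + \<delta> * nabla x b = B"
      unfolding S using distinct by (auto simp: F_def)
    then show ?thesis
      unfolding solves_bvp_def by blast
  qed
  have lin: "linear_form ?S (F t)" if "t \<in> ?S" for t
  proof -
    have "a + 1 \<in> nats_between (a + 1) b" "b \<in> nats_between (a + 1) b"
      using b1 \<open>a + 2 \<le> b\<close> nats_from_base by (auto simp: nats_between_def)
    moreover have "a \<in> ?S" "b \<in> ?S"
      using S by simp_all
    ultimately have "linear_form ?S (\<lambda>x. \<alpha> * x a - \<beta> * nabla x (a + 1))"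
      "linear_form ?S (\<lambda>x. \<gamma> * x b + \<delta> * nabla x b)"
      by (auto intro!: linear_form_add linear_form_diff linear_form_mult
          linear_form_nabla linear_form_eval finite_nats_between)
    moreover have "linear_form ?S (\<lambda>x. L_op \<nu> a p q x t)" if "t \<noteq> a" "t \<noteq> b"
      using \<open>t \<in> ?S\<close> that S by (intro linear_form_L_op) auto
    ultimately show ?thesis
      unfolding F_def by (cases "t = a"; cases "t = b") simp_all
  qed
  \<comment> \<open>For zero data all three branches of the right-hand side in \<open>solves\<close>
    vanish, so the assumption on the homogeneous problem is the kernel condition for
    \<open>F\<close>.\<close>
  have "\<forall>s\<in>?S. x s = 0" if "x \<in> ?S \<rightarrow>\<^sub>E UNIV" "\<forall>t\<in>?S. F t x = 0" for x
    using assms(7)[of x] solves[of "\<lambda>t. 0" 0 0 x] that by simp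
  then show "\<exists>!x. solves_bvp \<nu> a b p q \<alpha> \<beta> \<gamma> \<delta> h A B x"
    unfolding solves by (intro square_linear_system_unique_solution finite_nats_between lin)
qed

end
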